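(* Let $(\mathfrak g,\mathfrak g_r^* )$ be a factorizable mock-pre-Lie bialgebra with $I=r_+-r_-$, and let $\lambda\in\mathbb K$. Then $(\mathfrak g,B,\omega_I)$ is a quadratic Rota-Baxter mock-pre-Lie algebra of weight $\lambda$, where the linear map $B:\mathfrak g\to\mathfrak g$ and $\omega_I\in\wedge^2\mathfrak g^*$ are defined respectively by $B=\lambda\,r_-\circ I^{-1}$ and $\omega_I(x,y)=\langle I^{-1}x,y\rangle$ for all $x,y\in\mathfrak g$.
   Context: All vector spaces are finite-dimensional over an algebraically closed field $\mathbb K$ of characteristic $0$. A mock-pre-Lie algebra is a vector space with a bilinear product satisfying $(x\cdot y)\cdot z+x\cdot(y\cdot z)=-(y\cdot x)\cdot z-y\cdot(x\cdot z)$. Write $\{x,y\}_c=x\cdot_{\mathfrak g}y+y\cdot_{\mathfrak g}x$, $L_xy=x\cdot_{\mathfrak g}y$, $R_xy=y\cdot_{\mathfrak g}x$, $\langle L_x^*\xi,y\rangle=-\langle\xi,x\cdot_{\mathfrak g}y\rangle$, $\langle R_x^*\xi,y\rangle=-\langle\xi,y\cdot_{\mathfrak g}x\rangle$. For $r\in\mathfrak g\otimes\mathfrak g$ define $r_\pm:\mathfrak g^*\to\mathfrak g$ by $\langle r_+(\xi),\eta\rangle=r(\xi,\eta)$, $\langle r_-(\xi),\eta\rangle=r(\eta,\xi)$, and $I=r_+-r_-$. For $r=\sum_ia_i\otimes b_i$ let $$[[r,r]]=\sum_{i,j}\big(-a_i\cdot_{\mathfrak g}a_j\otimes b_j\otimes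 b_i-b_j\otimes a_i\cdot_{\mathfrak g}a_j\otimes b_i+a_j\otimes\{a_i,b_j\}_c\otimes b_i+\{a_i,b_j\}_c\otimes a_j\otimes b_i-a_i\otimes a_j\otimes\{b_i,b_j\}_c\big).$$ An element $s\in\mathfrak g\otimes\mathfrak g$ is $(L,L+R)$-invariant if $(L_x\otimes\mathrm{Id}-\mathrm{Id}\otimes(L_x+R_x))s=0$ for all $x$. $r$ induces on $\mathfrak g^*$ the product $\xi\cdot_r\eta=-(L^*_{r_+(\xi)}+R^*_{r_+(\xi)})\eta+R^*_{r_-(\eta)}\xi$; write $\mathfrak g_r^*=(\mathfrak g^*,\cdot_r)$. If $[[r,r]]=0$ and the skew-symmetric part $r_a$ of $r$ is $(L,L+R)$-invariant, then $(\mathfrak g,\mathfrak g_r^* )$ is a mock-pre-Lie bialgebra, called quasi-triangular (so "quasi-triangular" means these two conditions on $r$). It is called factorizable if moreover $I:\mathfrak g^*\to\mathfrak g$ is a linear isomorphism (equivalently $r_a$ is nondegenerate). A Rota-Baxter operator of weight $\lambda$ on $(\mathfrak g,\cdot_{\mathfrak g})$ is a linear map $B:\mathfrak g\to\mathfrak g$ with $(Bx)\cdot_{\mathfrak g}(By)=B((Bx)\cdot_{\mathfrak g}y+x\cdot_{\mathfrak g}(By)+\lambda x\cdot_{\mathfrak g}y)$. A quadratic mock-pre-Lie algebra $(\mathfrak g,\cdot_{\mathfrak g},\omega)$ has a nondegenerate skew-symmetric bilinear form $\omega$ with $\omega(x\cdot_{\mathfrak g}y,z)=\omega(y,\{x,z\}_c)$.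 A quadratic Rota-Baxter mock-pre-Lie algebra of weight $\lambda$, $(\mathfrak g,\cdot_{\mathfrak g},B,\omega)$ (also written $(\mathfrak g,B,\omega)$), is a quadratic mock-pre-Lie algebra with a Rota-Baxter operator $B$ of weight $\lambda$ such that $\omega(Bx,y)+\omega(x,By)+\lambda\omega(x,y)=0$ for all $x,y$. *)

theory Defs
  imports
    "HOL-Computational_Algebra.Polynomial"
    "HOL-Library.Function_Algebras"
begin

section \<open>Dual space and tensors\<close>

text \<open>
  A vector space \<open>\<gg>\<close> is a type \<open>'g\<close> with a scalar multiplication \<open>scale\<close>. Its dual is a set of
  functions. For finite-dimensional \<open>\<gg>\<close> the tensor powers are realised as multilinear forms on the
  dual, where \<open>x \<otimes> y\<close> is the form \<open>(\<xi>, \<eta>) \<mapsto> \<xi>(x) \<eta>(y)\<close>. Forms are set to \<open>0\<close> outside the dual,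
  so that equality of functions is equality of tensors. Sums, differences and \<open>0\<close> of tensors are
  the pointwise ones of \<^theory>\<open>HOL-Library.Function_Algebras\<close>.
\<close>

definition dual_space :: "('k::field \<Rightarrow> 'g::ab_group_add \<Rightarrow> 'g) \<Rightarrow> ('g \<Rightarrow> 'k) set" where
  "dual_space scale = {\<xi>. Vector_Spaces.linear scale (*) \<xi>}"

type_synonym ('k, 'g) tensor2 = "('g \<Rightarrow> 'k) \<Rightarrow> ('g \<Rightarrow> 'k) \<Rightarrow> 'k"
type_synonym ('k, 'g) tensor3 = "('g \<Rightarrow> 'k) \<Rightarrow> ('g \<Rightarrow> 'k) \<Rightarrow> ('g \<Rightarrow> 'k) \<Rightarrow> 'k"

definition tens2 ::
  "('k::field \<Rightarrow> 'g::ab_group_add \<Rightarrow> 'g) \<Rightarrow> 'g \<Rightarrow> 'g \<Rightarrow> ('k, 'g) tensor2" where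
  "tens2 scale x y = (\<lambda>\<xi> \<eta>. if \<xi> \<in> dual_space scale \<and> \<eta> \<in> dual_space scale
     then \<xi> x * \<eta> y else 0)"

definition tens3 ::
  "('k::field \<Rightarrow> 'g::ab_group_add \<Rightarrow> 'g) \<Rightarrow> 'g \<Rightarrow> 'g \<Rightarrow> 'g \<Rightarrow> ('k, 'g) tensor3" where
  "tens3 scale x y z = (\<lambda>\<xi> \<eta> \<zeta>.
     if \<xi> \<in> dual_space scale \<and> \<eta> \<in> dual_space scale \<and> \<zeta> \<in> dual_space scale
     then \<xi> x * \<eta> y * \<zeta> z else 0)"

definition tensor_square ::
  "('k::field \<Rightarrow> 'g::ab_group_add \<Rightarrow> 'g) \<Rightarrow> ('k, 'g) tensor2 set" where
  "tensor_square scale = {r. \<exists>(n::nat) a b. r = (\<Sum>i<n. tens2 scale (a i) (b i))}"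

text \<open>The map \<open>f \<otimes> g\<close> on tensors, for linear endomorphisms \<open>f\<close> and \<open>g\<close>;
  see \<open>map_tens2_sum\<close> below.\<close>

definition map_tens2 ::
  "('k::field \<Rightarrow> 'g::ab_group_add \<Rightarrow> 'g) \<Rightarrow> ('g \<Rightarrow> 'g) \<Rightarrow> ('g \<Rightarrow> 'g)
    \<Rightarrow> ('k, 'g) tensor2 \<Rightarrow> ('k, 'g) tensor2" where
  "map_tens2 scale f g s = (\<lambda>\<xi> \<eta>. if \<xi> \<in> dual_space scale \<and> \<eta> \<in> dual_space scale
     then s (\<xi> \<circ> f) (\<eta> \<circ> g) else 0)"

definition skew_part :: "('k::field, 'g) tensor2 \<Rightarrow> ('k, 'g) tensor2" where
  "skew_part r = (\<lambda>\<xi> \<eta>. (r \<xi> \<eta> - r \<eta> \<xi>) / 2)"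

text \<open>The vectors \<open>r\<^sub>+(\<xi>)\<close> and \<open>r\<^sub>-(\<xi>)\<close> are determined by their pairings with the dual;
  see \<open>r_plus_sum\<close> and \<open>r_minus_sum\<close> below for their existence and uniqueness.\<close>

definition r_plus ::
  "('k::field \<Rightarrow> 'g::ab_group_add \<Rightarrow> 'g) \<Rightarrow> ('k, 'g) tensor2 \<Rightarrow> ('g \<Rightarrow> 'k) \<Rightarrow> 'g" where
  "r_plus scale r \<xi> = (THE x. \<forall>\<eta>\<in>dual_space scale. \<eta> x = r \<xi> \<eta>)"

definition r_minus ::
  "('k::field \<Rightarrow> 'g::ab_group_add \<Rightarrow> 'g) \<Rightarrow> ('k, 'g) tensor2 \<Rightarrow> ('g \<Rightarrow> 'k) \<Rightarrow> 'g" where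
  "r_minus scale r \<xi> = (THE x. \<forall>\<eta>\<in>dual_space scale. \<eta> x = r \<eta> \<xi>)"

definition I_map ::
  "('k::field \<Rightarrow> 'g::ab_group_add \<Rightarrow> 'g) \<Rightarrow> ('k, 'g) tensor2 \<Rightarrow> ('g \<Rightarrow> 'k) \<Rightarrow> 'g" where
  "I_map scale r \<xi> = r_plus scale r \<xi> - r_minus scale r \<xi>"

text \<open>The inverse of \<open>I\<close>, as a map from \<open>\<gg>\<close> to its dual.\<close>

definition I_inv ::
  "('k::field \<Rightarrow> 'g::ab_group_add \<Rightarrow> 'g) \<Rightarrow> ('k, 'g) tensor2 \<Rightarrow> 'g \<Rightarrow> ('g \<Rightarrow> 'k)" where
  "I_inv scale r = inv_into (dual_space scale) (I_map scale r)"


section \<open>Mock-pre-Lie algebras\<close>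

locale mock_pre_Lie_algebra =
  finite_dimensional_vector_space scale Basis
  for scale :: "'k::{alg_closed_field, field_char_0} \<Rightarrow> 'g::ab_group_add \<Rightarrow> 'g"
    and Basis :: "'g set" +
  fixes mul :: "'g \<Rightarrow> 'g \<Rightarrow> 'g"
  assumes linear_mult_left: "Vector_Spaces.linear scale scale (\<lambda>x. mul x y)"
    and linear_mult_right: "Vector_Spaces.linear scale scale (\<lambda>y. mul x y)"
    and mock_pre_Lie:
      "mul (mul x y) z + mul x (mul y z) = - mul (mul y x) z - mul y (mul x z)"

definition cbracket :: "('g \<Rightarrow> 'g \<Rightarrow> 'g::ab_group_add) \<Rightarrow> 'g \<Rightarrow> 'g \<Rightarrow> 'g" where
  "cbracket mul x y = mul x y + mul y x"

definition double_bracket_sum ::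
  "('k::field \<Rightarrow> 'g::ab_group_add \<Rightarrow> 'g) \<Rightarrow> ('g \<Rightarrow> 'g \<Rightarrow> 'g)
    \<Rightarrow> nat \<Rightarrow> (nat \<Rightarrow> 'g) \<Rightarrow> (nat \<Rightarrow> 'g) \<Rightarrow> ('k, 'g) tensor3" where
  "double_bracket_sum scale mul n a b = (\<Sum>i<n. \<Sum>j<n.
     - tens3 scale (mul (a i) (a j)) (b j) (b i)
     - tens3 scale (b j) (mul (a i) (a j)) (b i)
     + tens3 scale (a j) (cbracket mul (a i) (b j)) (b i)
     + tens3 scale (cbracket mul (a i) (b j)) (a j) (b i)
     - tens3 scale (a i) (a j) (cbracket mul (b i) (b j)))"

text \<open>\<open>[[r, r]]\<close> does not depend on the way \<open>r\<close> is written as a sum of pure tensors;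
  see \<open>double_bracket_eq\<close> below.\<close>

definition double_bracket ::
  "('k::field \<Rightarrow> 'g::ab_group_add \<Rightarrow> 'g) \<Rightarrow> ('g \<Rightarrow> 'g \<Rightarrow> 'g)
    \<Rightarrow> ('k, 'g) tensor2 \<Rightarrow> ('k, 'g) tensor3" where
  "double_bracket scale mul r = (THE t. \<exists>n a b.
     r = (\<Sum>i<n. tens2 scale (a i) (b i)) \<and> t = double_bracket_sum scale mul n a b)"

definition L_LR_invariant ::
  "('k::field \<Rightarrow> 'g::ab_group_add \<Rightarrow> 'g) \<Rightarrow> ('g \<Rightarrow> 'g \<Rightarrow> 'g)
    \<Rightarrow> ('k, 'g) tensor2 \<Rightarrow> bool" where
  "L_LR_invariant scale mul s \<longleftrightarrow>
     (\<forall>x. map_tens2 scale (\<lambda>y. mul x y) (\<lambda>y. y) s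
        - map_tens2 scale (\<lambda>y. y) (\<lambda>y. mul x y + mul y x) s = 0)"

text \<open>The bialgebra \<open>(\<gg>, \<gg>\<^sub>r\<^sup>*)\<close> is determined by \<open>\<gg>\<close> and \<open>r\<close>.\<close>

locale quasi_triangular_mock_pre_Lie_bialgebra =
  mock_pre_Lie_algebra scale Basis mul
  for scale :: "'k::{alg_closed_field, field_char_0} \<Rightarrow> 'g::ab_group_add \<Rightarrow> 'g"
    and Basis mul +
  fixes r :: "('k, 'g) tensor2"
  assumes r_in_tensor_square: "r \<in> tensor_square scale"
    and double_bracket_zero: "double_bracket scale mul r = 0"
    and skew_part_invariant: "L_LR_invariant scale mul (skew_part r)"

text \<open>The map \<open>I\<close> is linear on the dual for every tensor \<open>r\<close> (\<open>I_map_add\<close>, \<open>I_map_scale\<close> below),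
  so it is a linear isomorphism if and only if it is bijective.\<close>

locale factorizable_mock_pre_Lie_bialgebra =
  quasi_triangular_mock_pre_Lie_bialgebra scale Basis mul r
  for scale :: "'k::{alg_closed_field, field_char_0} \<Rightarrow> 'g::ab_group_add \<Rightarrow> 'g"
    and Basis mul r +
  assumes I_iso: "bij_betw (I_map scale r) (dual_space scale) UNIV"

locale quadratic_mock_pre_Lie_algebra =
  mock_pre_Lie_algebra scale Basis mul
  for scale :: "'k::{alg_closed_field, field_char_0} \<Rightarrow> 'g::ab_group_add \<Rightarrow> 'g"
    and Basis mul +
  fixes \<omega> :: "'g \<Rightarrow> 'g \<Rightarrow> 'k"
  assumes linear_form_left: "Vector_Spaces.linear scale (*) (\<lambda>x. \<omega> x y)"
    and linear_form_right: "Vector_Spaces.linear scale (*) (\<lambda>y. \<omega> x y)"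
    and form_skew: "\<omega> x y = - \<omega> y x"
    and form_nondegenerate: "(\<And>y. \<omega> x y = 0) \<Longrightarrow> x = 0"
    and form_invariant: "\<omega> (mul x y) z = \<omega> y (cbracket mul x z)"

locale quadratic_Rota_Baxter_mock_pre_Lie_algebra =
  quadratic_mock_pre_Lie_algebra scale Basis mul \<omega>
  for scale :: "'k::{alg_closed_field, field_char_0} \<Rightarrow> 'g::ab_group_add \<Rightarrow> 'g"
    and Basis mul \<omega> +
  fixes wt :: 'k and B :: "'g \<Rightarrow> 'g"
  assumes linear_B: "Vector_Spaces.linear scale scale B"
    and Rota_Baxter:
      "mul (B x) (B y) = B (mul (B x) y + mul x (B y) + scale wt (mul x y))"
    and form_B: "\<omega> (B x) y + \<omega> x (B y) + wt * \<omega> x y = 0"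


section \<open>Well-definedness\<close>

lemma sum_fun_apply: "(\<Sum>i\<in>A. f i) x = (\<Sum>i\<in>A. f i x)"
  for f :: "'i \<Rightarrow> 'a \<Rightarrow> 'b::comm_monoid_add"
  by (induction A rule: infinite_finite_induct) auto

lemma dual_space_simps:
  assumes "\<xi> \<in> dual_space scale"
  shows "\<xi> (x + y) = \<xi> x + \<xi> y" "\<xi> (scale c x) = c * \<xi> x" "\<xi> (x - y) = \<xi> x - \<xi> y"
    "\<xi> (\<Sum>i\<in>A. f i) = (\<Sum>i\<in>A. \<xi> (f i))"
proof -
  interpret \<xi>: Vector_Spaces.linear scale "(*)" \<xi>
    using assms by (simp add: dual_space_def)
  show "\<xi> (x + y) = \<xi> x + \<xi> y" "\<xi> (scale c x) = c * \<xi> x" "\<xi> (x - y) = \<xi> x - \<xi> y"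
    "\<xi> (\<Sum>i\<in>A. f i) = (\<Sum>i\<in>A. \<xi> (f i))"
    by (rule \<xi>.add \<xi>.scale \<xi>.diff \<xi>.sum)+
qed

lemma dual_space_comp:
  assumes "\<xi> \<in> dual_space scale" "Vector_Spaces.linear scale scale f"
  shows "\<xi> \<circ> f \<in> dual_space scale"
  using assms Vector_Spaces.linear_compose unfolding dual_space_def by blast

lemma dual_space_add:
  assumes "\<xi> \<in> dual_space scale" "\<eta> \<in> dual_space scale"
  shows "(\<lambda>x. \<xi> x + \<eta> x) \<in> dual_space scale"
  using assms by (auto simp: dual_space_def Vector_Spaces.linear_iff algebra_simps)

lemma dual_space_scale:
  assumes "\<xi> \<in> dual_space scale"
  shows "(\<lambda>x. c * \<xi> x) \<in> dual_space scale"
  using assms by (auto simp: dual_space_def Vector_Spaces.linear_iff algebra_simps)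

lemma map_tens2_sum:
  assumes "Vector_Spaces.linear scale scale f" "Vector_Spaces.linear scale scale g"
  shows "map_tens2 scale f g (\<Sum>i<n. tens2 scale (a i) (b i))
    = (\<Sum>i<n. tens2 scale (f (a i)) (g (b i)))"
  by (intro ext) (auto simp: map_tens2_def tens2_def sum_fun_apply dual_space_comp assms
      intro!: sum.neutral)

context vector_space
begin

lemma dual_space_separates:
  assumes "\<And>\<eta>. \<eta> \<in> dual_space scale \<Longrightarrow> \<eta> x = \<eta> y"
  shows "x = y"
proof (rule ccontr)
  assume "x \<noteq> y"
  then have ind: "independent {x - y}"
    by simp
  interpret P: vector_space_pair scale "(*) :: 'a \<Rightarrow> 'a \<Rightarrow> 'a"
    by (intro vector_space_pair.intro vector_space_axioms)
       (unfold_locales, simp_all add: algebra_simps)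
  let ?f = "P.construct {x - y} (\<lambda>_. 1)"
  have f: "?f \<in> dual_space scale"
    using P.linear_construct[OF ind] by (simp add: dual_space_def)
  have "?f (x - y) = 1"
    using P.construct_basis[OF ind] by simp
  moreover have "?f (x - y) = 0"
    using assms[OF f] dual_space_simps(3)[OF f] by simp
  ultimately show False
    by simp
qed

lemma r_plus_sum:
  assumes "\<xi> \<in> dual_space scale"
  shows "r_plus scale (\<Sum>i<n. tens2 scale (a i) (b i)) \<xi> = (\<Sum>i<n. scale (\<xi> (a i)) (b i))"
  unfolding r_plus_def
proof (rule the_equality)
  show *: "\<forall>\<eta>\<in>dual_space scale.
      \<eta> (\<Sum>i<n. scale (\<xi> (a i)) (b i)) = (\<Sum>i<n. tens2 scale (a i) (b i)) \<xi> \<eta>"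
    using assms by (simp add: dual_space_simps sum_fun_apply tens2_def)
  show "x = (\<Sum>i<n. scale (\<xi> (a i)) (b i))"
    if "\<forall>\<eta>\<in>dual_space scale. \<eta> x = (\<Sum>i<n. tens2 scale (a i) (b i)) \<xi> \<eta>" for x
    using that * by (intro dual_space_separates) simp
qed

lemma r_minus_sum:
  assumes "\<xi> \<in> dual_space scale"
  shows "r_minus scale (\<Sum>i<n. tens2 scale (a i) (b i)) \<xi> = (\<Sum>i<n. scale (\<xi> (b i)) (a i))"
  unfolding r_minus_def
proof (rule the_equality)
  show *: "\<forall>\<eta>\<in>dual_space scale.
      \<eta> (\<Sum>i<n. scale (\<xi> (b i)) (a i)) = (\<Sum>i<n. tens2 scale (a i) (b i)) \<eta> \<xi>"
    using assms by (simp add: dual_space_simps sum_fun_apply tens2_def mult.commute)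
  show "x = (\<Sum>i<n. scale (\<xi> (b i)) (a i))"
    if "\<forall>\<eta>\<in>dual_space scale. \<eta> x = (\<Sum>i<n. tens2 scale (a i) (b i)) \<eta> \<xi>" for x
    using that * by (intro dual_space_separates) simp
qed

lemma I_map_add:
  assumes "r \<in> tensor_square scale" "\<xi> \<in> dual_space scale" "\<eta> \<in> dual_space scale"
  shows "I_map scale r (\<lambda>x. \<xi> x + \<eta> x) = I_map scale r \<xi> + I_map scale r \<eta>"
  using assms
  by (auto simp: tensor_square_def I_map_def r_plus_sum r_minus_sum dual_space_add
      scale_left_distrib sum.distrib)

lemma I_map_scale:
  assumes "r \<in> tensor_square scale" "\<xi> \<in> dual_space scale"
  shows "I_map scale r (\<lambda>x. c * \<xi> x) = scale c (I_map scale r \<xi>)"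
  using assms
  by (auto simp: tensor_square_def I_map_def r_plus_sum r_minus_sum dual_space_scale
      scale_right_diff_distrib scale_sum_right)

end

context mock_pre_Lie_algebra
begin

lemma mult_sum_sum:
  "mul (\<Sum>i\<in>A. scale (c i) (x i)) (\<Sum>j\<in>C. scale (d j) (y j))
    = (\<Sum>i\<in>A. \<Sum>j\<in>C. scale (c i * d j) (mul (x i) (y j)))"
proof -
  interpret l: Vector_Spaces.linear scale scale "\<lambda>x. mul x z" for z
    by (rule linear_mult_left)
  interpret r: Vector_Spaces.linear scale scale "\<lambda>y. mul z y" for z
    by (rule linear_mult_right)
  show ?thesis
    by (simp add: l.sum r.sum l.scale r.scale scale_sum_right mult.commute sum.swap[of _ C A])
qed

lemma double_bracket_sum_apply:
  assumes r: "r = (\<Sum>i<n. tens2 scale (a i) (b i))"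
    and d: "\<xi> \<in> dual_space scale" "\<eta> \<in> dual_space scale" "\<zeta> \<in> dual_space scale"
  shows "double_bracket_sum scale mul n a b \<xi> \<eta> \<zeta> =
    - \<xi> (mul (r_minus scale r \<zeta>) (r_minus scale r \<eta>))
    - \<eta> (mul (r_minus scale r \<zeta>) (r_minus scale r \<xi>))
    + \<eta> (cbracket mul (r_minus scale r \<zeta>) (r_plus scale r \<xi>))
    + \<xi> (cbracket mul (r_minus scale r \<zeta>) (r_plus scale r \<eta>))
    - \<zeta> (cbracket mul (r_plus scale r \<xi>) (r_plus scale r \<eta>))"
proof -
  have m: "\<theta> (mul (\<Sum>i<n. scale (c i) (x i)) (\<Sum>j<n. scale (d j) (y j)))
      = (\<Sum>i<n. \<Sum>j<n. c i * d j * \<theta> (mul (x i) (y j)))"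
    if "\<theta> \<in> dual_space scale" for \<theta> c d x y
    using that by (simp add: mult_sum_sum dual_space_simps)
  have cb: "\<theta> (cbracket mul (\<Sum>i<n. scale (c i) (x i)) (\<Sum>j<n. scale (d j) (y j)))
      = (\<Sum>i<n. \<Sum>j<n. c i * d j * \<theta> (cbracket mul (x i) (y j)))"
    if t: "\<theta> \<in> dual_space scale" for \<theta> c d x y
  proof -
    have "(\<Sum>i<n. \<Sum>j<n. d i * c j * \<theta> (mul (y i) (x j)))
        = (\<Sum>i<n. \<Sum>j<n. c i * d j * \<theta> (mul (y j) (x i)))"
      by (subst sum.swap) (simp add: mult.commute)
    then show ?thesis
      by (simp add: cbracket_def dual_space_simps[OF t] m[OF t] distrib_left sum.distrib)
  qed
  show ?thesis
    unfolding r r_plus_sum[OF d(1)] r_plus_sum[OF d(2)] r_minus_sum[OF d(1)]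
      r_minus_sum[OF d(2)] r_minus_sum[OF d(3)] m[OF d(1)] m[OF d(2)] cb[OF d(1)]
      cb[OF d(2)] cb[OF d(3)]
    using d by (simp add: double_bracket_sum_def sum_fun_apply tens3_def sum.distrib
        sum_subtractf sum_negf mult_ac)
qed

lemma double_bracket_sum_outside:
  assumes "\<not> (\<xi> \<in> dual_space scale \<and> \<eta> \<in> dual_space scale \<and> \<zeta> \<in> dual_space scale)"
  shows "double_bracket_sum scale mul n a b \<xi> \<eta> \<zeta> = 0"
  using assms by (auto simp: double_bracket_sum_def sum_fun_apply tens3_def)

lemma double_bracket_eq:
  assumes "r = (\<Sum>i<n. tens2 scale (a i) (b i))"
  shows "double_bracket scale mul r = double_bracket_sum scale mul n a b"
  unfolding double_bracket_def
proof (rule the_equality)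
  show "\<exists>n' a' b'. r = (\<Sum>i<n'. tens2 scale (a' i) (b' i)) \<and>
      double_bracket_sum scale mul n a b = double_bracket_sum scale mul n' a' b'"
    using assms by blast
next
  fix t
  assume "\<exists>n a b. r = (\<Sum>i<n. tens2 scale (a i) (b i)) \<and> t = double_bracket_sum scale mul n a b"
  then obtain n' a' b' where *: "r = (\<Sum>i<n'. tens2 scale (a' i) (b' i))"
      "t = double_bracket_sum scale mul n' a' b'"
    by blast
  show "t = double_bracket_sum scale mul n a b"
  proof (intro ext)
    fix \<xi> \<eta> \<zeta>
    show "t \<xi> \<eta> \<zeta> = double_bracket_sum scale mul n a b \<xi> \<eta> \<zeta>"
    proof (cases "\<xi> \<in> dual_space scale \<and> \<eta> \<in> dual_space scale \<and> \<zeta> \<in> dual_space scale")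
      case True
      then have d: "\<xi> \<in> dual_space scale" "\<eta> \<in> dual_space scale" "\<zeta> \<in> dual_space scale"
        by auto
      show ?thesis
        unfolding *(2) double_bracket_sum_apply[OF *(1) d] double_bracket_sum_apply[OF assms d] ..
    next
      case False
      then show ?thesis
        by (simp add: *(2) double_bracket_sum_outside)
    qed
  qed
qed

end

end

theory Submission
  imports Defs
begin

text \<open>
  Put \<open>N = r\<^sub>- \<circ> I\<^sup>-\<^sup>1\<close>, so that \<open>r\<^sub>+ \<circ> I\<^sup>-\<^sup>1 = 1 + N\<close> and \<open>B = \<lambda> N\<close>. That \<open>r\<^sub>+\<close> and \<open>r\<^sub>-\<close> are mutually
  transposed makes \<open>\<omega>\<^sub>I\<close> skew and gives \<open>\<omega>(N x, y) + \<omega>(x, N y) + \<omega>(x, y) = 0\<close>; the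
  invariance of \<open>r\<^sub>a\<close> is the invariance of \<open>\<omega>\<^sub>I\<close>.

  Let \<open>t(x, y, z) = \<omega>(x, y \<cdot> z)\<close> and let \<open>G(x, y, z)\<close> be the pairing of \<open>x\<close> with the failure of the weight
  one Rota-Baxter identity for \<open>N\<close> at \<open>(y, z)\<close>. Invariance says that \<open>t\<close> is symmetric in its first
  two arguments and has vanishing cyclic sum. Hence \<open>G\<close> is symmetric in its first two arguments,
  while \<open>[[r, r]] = 0\<close> becomes \<open>G(x, z, y) + G(y, z, x) = 0\<close>. A trilinear function symmetric
  under one transposition and skew under another vanishes.
\<close>

text \<open>The two transpositions compose to a 3-cycle, whose cube is the identity. Going round
  three times uses \<open>skew\<close> three times, so the value equals its own negative.\<close>

lemma symmetric_skew_eq_0: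
  fixes G :: "'a \<Rightarrow> 'a \<Rightarrow> 'a \<Rightarrow> 'k::field_char_0"
  assumes sym: "\<And>x y z. G x y z = G y x z"
    and skew: "\<And>x y z. G x y z = - G z y x"
  shows "G x y z = 0"
proof -
  have "G x y z = G y x z" by (rule sym)
  also have "\<dots> = - G z x y" by (rule skew)
  also have "\<dots> = - G x z y" by (subst sym) (rule refl)
  also have "\<dots> = G y z x" by (subst skew) simp
  also have "\<dots> = G z y x" by (rule sym)
  also have "\<dots> = - G x y z" by (rule skew)
  finally have "G x y z + G x y z = 0"
    by (simp only: eq_neg_iff_add_eq_0)
  then show ?thesis
    by (simp flip: mult_2)
qed

section \<open>Quadratic algebras and weight-one Rota-Baxter operators\<close>

context quadratic_mock_pre_Lie_algebra
begin

lemma form_simps: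
  "\<omega> (x + y) z = \<omega> x z + \<omega> y z" "\<omega> x (y + z) = \<omega> x y + \<omega> x z"
  "\<omega> (x - y) z = \<omega> x z - \<omega> y z" "\<omega> x (y - z) = \<omega> x y - \<omega> x z"
  "\<omega> (scale c x) y = c * \<omega> x y" "\<omega> x (scale c y) = c * \<omega> x y"
proof -
  interpret l: Vector_Spaces.linear scale "(*)" "\<lambda>x. \<omega> x y" for y
    by (rule linear_form_left)
  interpret r: Vector_Spaces.linear scale "(*)" "\<lambda>y. \<omega> x y" for x
    by (rule linear_form_right)
  show "\<omega> (x + y) z = \<omega> x z + \<omega> y z" "\<omega> x (y + z) = \<omega> x y + \<omega> x z"
    "\<omega> (x - y) z = \<omega> x z - \<omega> y z" "\<omega> x (y - z) = \<omega> x y - \<omega> x z"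
    "\<omega> (scale c x) y = c * \<omega> x y" "\<omega> x (scale c y) = c * \<omega> x y"
    by (simp_all add: l.add r.add l.diff r.diff l.scale r.scale)
qed

lemma mul_simps:
  "mul (x + y) z = mul x z + mul y z" "mul x (y + z) = mul x y + mul x z"
  "mul (scale c x) y = scale c (mul x y)" "mul x (scale c y) = scale c (mul x y)"
proof -
  interpret l: Vector_Spaces.linear scale scale "\<lambda>x. mul x y" for y
    by (rule linear_mult_left)
  interpret r: Vector_Spaces.linear scale scale "\<lambda>y. mul x y" for x
    by (rule linear_mult_right)
  show "mul (x + y) z = mul x z + mul y z" "mul x (y + z) = mul x y + mul x z"
    "mul (scale c x) y = scale c (mul x y)" "mul x (scale c y) = scale c (mul x y)"
    by (simp_all add: l.add r.add l.scale r.scale)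
qed

lemma form_eqI:
  assumes "\<And>z. \<omega> x z = \<omega> y z"
  shows "x = y"
  using form_nondegenerate[of "x - y"] assms by (simp add: form_simps)

lemma form_cbracket: "\<omega> x (cbracket mul y z) = - \<omega> z (mul y x)"
  using form_invariant[of y x z] form_skew[of z "mul y x"] by simp

text \<open>\<open>cbracket\<close> is symmetric, so its two slots in \<open>form_cbracket\<close>
  may be exchanged.\<close>

lemma form_mul_swap: "\<omega> x (mul y z) = \<omega> y (mul x z)"
proof -
  have "\<omega> z (cbracket mul y x) = \<omega> z (cbracket mul x y)"
    by (simp add: cbracket_def add.commute)
  then show ?thesis
    by (simp add: form_cbracket)
qed

text \<open>Expand the bracket in \<open>form_cbracket\<close>; two swaps bring the terms into
  cyclic order.\<close>

lemma form_mul_cyclic: "\<omega> x (mul y z) + \<omega> y (mul z x) + \<omega> z (mul x y) = 0"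
  using form_cbracket[of x y z] form_mul_swap[of y z x] form_mul_swap[of x z y]
  by (simp add: cbracket_def form_simps eq_neg_iff_add_eq_0 add_ac)

text \<open>The hypothesis moves \<open>N\<close> to the other slot, so
  \<open>\<omega> (N x) y\<close> is linear in \<open>x\<close>; nondegeneracy passes this on to
  \<open>N\<close>.\<close>

lemma linear_skew_adjoint:
  assumes "\<And>x y. \<omega> (N x) y + \<omega> x (N y) + c * \<omega> x y = 0"
  shows "Vector_Spaces.linear scale scale N"
proof -
  have N: "\<omega> (N x) y = - \<omega> x (N y) - c * \<omega> x y" for x y
    using assms[of x y] by (simp add: algebra_simps eq_neg_iff_add_eq_0)
  have "N (x + y) = N x + N y" "N (scale d x) = scale d (N x)" for x y d
    by (rule form_eqI, simp add: N form_simps algebra_simps)+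
  then show ?thesis
    by (simp add: Vector_Spaces.linear_iff vector_space_axioms)
qed

lemma Rota_Baxter_one:
  assumes adj: "\<And>x y. \<omega> (N x) y + \<omega> x (N y) + \<omega> x y = 0"
    and br: "\<And>x y z. - \<omega> x (mul (N z) (N y)) - \<omega> y (mul (N z) (N x))
      + \<omega> y (cbracket mul (N z) (x + N x)) + \<omega> x (cbracket mul (N z) (y + N y))
      - \<omega> z (cbracket mul (x + N x) (y + N y)) = 0"
  shows "mul (N x) (N y) = N (mul (N x) y + mul x (N y) + mul x y)"
proof -
  \<comment> \<open>The defect at \<open>(z, y)\<close> paired with \<open>x\<close>, once
    \<open>adj\<close> has moved the outer \<open>N\<close> onto \<open>x\<close>.\<close>
  define G where "G x z y = \<omega> x (mul (N z) (N y)) + \<omega> (x + N x) (mul (N z) y)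
    + \<omega> (x + N x) (mul z (y + N y))" for x y z
  have G_defect: "G x z y = \<omega> x (mul (N z) (N y) - N (mul (N z) y + mul z (N y) + mul z y))"
    for x y z
  proof -
    have "\<omega> x (N w) = - \<omega> (x + N x) w" for w
      using adj[of x w] by (simp add: form_simps eq_neg_iff_add_eq_0 algebra_simps)
    then show ?thesis
      unfolding G_def form_simps(4) by (simp add: form_simps mul_simps)
  qed
  \<comment> \<open>Expansion gives seven terms, which the exchange of \<open>x\<close> and
    \<open>z\<close> permutes up to \<open>form_mul_swap\<close>.\<close>
  have sym: "G x z y = G z x y" for x y z
    by (simp add: G_def form_simps mul_simps form_mul_swap add_ac)
  have skew: "G x z y = - G y z x" for x y z
  proof -
    \<comment> \<open>Modulo \<open>br\<close> only three terms in \<open>x + N x\<close>,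
      \<open>z\<close>, \<open>y + N y\<close> remain; after one swap they form a cyclic
      sum.\<close>
    have "G x z y + G y z x = 0"
      using br[of x z y] form_mul_cyclic[of "x + N x" z "y + N y"]
        form_mul_swap[of z "y + N y" "x + N x"]
      unfolding form_cbracket G_def by algebra
    then show ?thesis
      by (simp add: eq_neg_iff_add_eq_0)
  qed
  have "G z x y = 0" for z
    using sym skew by (rule symmetric_skew_eq_0)
  then have "\<omega> z (mul (N x) (N y) - N (mul (N x) y + mul x (N y) + mul x y)) = 0" for z
    by (simp add: G_defect)
  then have "\<omega> (mul (N x) (N y) - N (mul (N x) y + mul x (N y) + mul x y)) z = 0" for z
    by (subst form_skew) simp
  then show ?thesis
    using form_nondegenerate[of "mul (N x) (N y) - N (mul (N x) y + mul x (N y) + mul x y)"]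
    by simp
qed

end

section \<open>From the tensor \<open>r\<close> to the form and the operator\<close>

context vector_space
begin

lemma
  assumes "r \<in> tensor_square scale" "\<xi> \<in> dual_space scale" "\<eta> \<in> dual_space scale"
  shows dual_r_plus: "\<eta> (r_plus scale r \<xi>) = r \<xi> \<eta>"
    and dual_r_minus: "\<eta> (r_minus scale r \<xi>) = r \<eta> \<xi>"
proof -
  obtain n :: nat and a b where r: "r = (\<Sum>i<n. tens2 scale (a i) (b i))"
    using assms(1) unfolding tensor_square_def by blast
  show "\<eta> (r_plus scale r \<xi>) = r \<xi> \<eta>" "\<eta> (r_minus scale r \<xi>) = r \<eta> \<xi>"
    using assms(2,3) unfolding r r_plus_sum[OF assms(2)] r_minus_sum[OF assms(2)]
    by (simp_all add: dual_space_simps sum_fun_apply tens2_def mult.commute)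
qed

end

context factorizable_mock_pre_Lie_bialgebra
begin

text \<open>Read with two arguments, \<open>J x y\<close> is the form
  \<open>\<omega>\<^sub>I\<close>.\<close>

abbreviation J where
  "J \<equiv> I_inv scale r"

abbreviation N where
  "N x \<equiv> r_minus scale r (J x)"

lemma J_dual [simp]: "J x \<in> dual_space scale"
  using bij_betw_apply[OF bij_betw_inv_into[OF I_iso]] by (simp add: I_inv_def)

lemma I_map_J: "I_map scale r (J x) = x"
  using bij_betw_inv_into_right[OF I_iso] by (simp add: I_inv_def)

lemma r_plus_J: "r_plus scale r (J x) = x + N x"
  using I_map_J[of x] by (simp add: I_map_def algebra_simps)

lemma J_I_map: "\<xi> \<in> dual_space scale \<Longrightarrow> J (I_map scale r \<xi>) = \<xi>"
  using bij_betw_inv_into_left[OF I_iso] by (simp add: I_inv_def)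

lemma dual_I_map:
  assumes "\<xi> \<in> dual_space scale" "\<eta> \<in> dual_space scale"
  shows "\<eta> (I_map scale r \<xi>) = r \<xi> \<eta> - r \<eta> \<xi>"
  using assms by (simp add: I_map_def dual_space_simps dual_r_plus dual_r_minus r_in_tensor_square)

lemma dual_I_map_skew_part:
  assumes "\<xi> \<in> dual_space scale" "\<eta> \<in> dual_space scale"
  shows "\<eta> (I_map scale r \<xi>) = 2 * skew_part r \<xi> \<eta>"
  using assms by (simp add: dual_I_map skew_part_def)

lemma J_skew: "J x y = - J y x"
  using dual_I_map[of "J x" "J y"] dual_I_map[of "J y" "J x"] by (simp add: I_map_J)

lemma J_adjoint: "J (N x) y + J x (N y) + J x y = 0"
proof -
  \<comment> \<open>Both sides are \<open>r (J y) (J x)\<close>.\<close>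
  have "J y (N x) = J x (y + N y)"
    using dual_r_minus[of r "J x" "J y"] dual_r_plus[of r "J y" "J x"]
    by (simp add: r_in_tensor_square r_plus_J)
  then show ?thesis
    using J_skew[of "N x" y] by (simp add: dual_space_simps[OF J_dual])
qed

text \<open>Invariance of \<open>skew_part r\<close>, read through
  \<open>\<eta> (I_map scale r \<xi>) = 2 * skew_part r \<xi> \<eta>\<close>.\<close>

lemma I_map_comp_mul:
  assumes \<xi>: "\<xi> \<in> dual_space scale"
  shows "I_map scale r (\<xi> \<circ> mul x) = cbracket mul x (I_map scale r \<xi>)"
proof (rule dual_space_separates)
  fix \<eta> assume \<eta>: "\<eta> \<in> dual_space scale"
  have lin: "Vector_Spaces.linear scale scale (\<lambda>y. mul x y + mul y x)"
    using linear_mult_left[of x] linear_mult_right[of x]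
    by (simp add: Vector_Spaces.linear_iff algebra_simps)
  have d: "\<xi> \<circ> mul x \<in> dual_space scale" "\<eta> \<circ> (\<lambda>y. mul x y + mul y x) \<in> dual_space scale"
    using \<xi> \<eta> linear_mult_right[of x] lin by (auto intro: dual_space_comp)
  have "map_tens2 scale (mul x) (\<lambda>y. y) (skew_part r) \<xi> \<eta>
      = map_tens2 scale (\<lambda>y. y) (\<lambda>y. mul x y + mul y x) (skew_part r) \<xi> \<eta>"
    using fun_cong[OF fun_cong[OF spec[OF skew_part_invariant[unfolded L_LR_invariant_def]]]]
    by (simp add: fun_diff_def zero_fun_def)
  moreover have "\<theta> \<circ> (\<lambda>y. y) = \<theta>" for \<theta> :: "'g \<Rightarrow> 'k"
    by auto
  ultimately have "skew_part r (\<xi> \<circ> mul x) \<eta> = skew_part r \<xi> (\<eta> \<circ> (\<lambda>y. mul x y + mul y x))"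
    using \<xi> \<eta> by (simp add: map_tens2_def)
  \<comment> \<open>The composite with \<open>\<eta>\<close> is kept folded, as a single functional
    to which \<open>dual_I_map_skew_part\<close> applies.\<close>
  then have "\<eta> (I_map scale r (\<xi> \<circ> mul x))
      = (\<eta> \<circ> (\<lambda>y. mul x y + mul y x)) (I_map scale r \<xi>)"
    using \<xi> \<eta> d by (simp add: dual_I_map_skew_part del: o_apply)
  then show "\<eta> (I_map scale r (\<xi> \<circ> mul x)) = \<eta> (cbracket mul x (I_map scale r \<xi>))"
    by (simp add: cbracket_def)
qed

lemma J_cbracket: "J (cbracket mul x y) z = J y (mul x z)"
proof -
  have "J y \<circ> mul x \<in> dual_space scale"
    using linear_mult_right by (auto intro: dual_space_comp)
  then show ?thesis
    using I_map_comp_mul[of "J y" x] J_I_map[of "J y \<circ> mul x"] by (simp add: I_map_J)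
qed

lemma quadratic_J: "quadratic_mock_pre_Lie_algebra scale Basis mul J"
proof (intro quadratic_mock_pre_Lie_algebra.intro quadratic_mock_pre_Lie_algebra_axioms.intro
    mock_pre_Lie_algebra_axioms)
  show "Vector_Spaces.linear scale (*) (J x)" for x
    using J_dual[of x] by (simp add: dual_space_def)
  show "Vector_Spaces.linear scale (*) (\<lambda>x. J x y)" for y
    using dual_space_scale[OF J_dual[of y], of "-1"] J_skew[of _ y] by (simp add: dual_space_def)
  show "J x y = - J y x" for x y
    by (rule J_skew)
  show "x = 0" if "\<And>y. J x y = 0" for x
  proof (rule dual_space_separates)
    fix \<eta> assume \<eta>: "\<eta> \<in> dual_space scale"
    \<comment> \<open>Skewness of \<open>I\<close> turns any functional at \<open>x\<close> into a
      value of \<open>J x\<close>, so the whole dual kills \<open>x\<close>.\<close>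
    have "\<eta> x = - J x (I_map scale r \<eta>)"
      using dual_I_map[OF J_dual \<eta>, of x] dual_I_map[OF \<eta> J_dual, of x] by (simp add: I_map_J)
    then show "\<eta> x = \<eta> 0"
      using that dual_space_simps(3)[OF \<eta>, of 0 0] by simp
  qed
  show "J (mul x y) z = J y (cbracket mul x z)" for x y z
    using J_skew[of "mul x y" z] J_skew[of y "cbracket mul x z"] by (simp add: J_cbracket)
qed

text \<open>Evaluate \<open>[[r, r]]\<close> at \<open>(J x, J y, J z)\<close>: there
  \<open>r_minus\<close> becomes \<open>N\<close> and \<open>r_plus\<close> becomes
  \<open>1 + N\<close>. This is the hypothesis \<open>br\<close> of
  \<open>Rota_Baxter_one\<close>.\<close>

lemma double_bracket_J:
  "- J x (mul (N z) (N y)) - J y (mul (N z) (N x))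
    + J y (cbracket mul (N z) (x + N x)) + J x (cbracket mul (N z) (y + N y))
    - J z (cbracket mul (x + N x) (y + N y)) = 0"
proof -
  obtain n :: nat and a b where r: "r = (\<Sum>i<n. tens2 scale (a i) (b i))"
    using r_in_tensor_square unfolding tensor_square_def by blast
  have "double_bracket_sum scale mul n a b (J x) (J y) (J z) = 0"
    using double_bracket_zero double_bracket_eq[OF r] by simp
  then show ?thesis
    by (simp add: double_bracket_sum_apply[OF r] flip: r_plus_J)
qed

end

theorem theorem5p5:
  fixes scale :: "'k::{alg_closed_field, field_char_0} \<Rightarrow> 'g::ab_group_add \<Rightarrow> 'g"
    and Basis :: "'g set"
    and mul :: "'g \<Rightarrow> 'g \<Rightarrow> 'g"
    and r :: "('k, 'g) tensor2"
    and wt :: 'k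
    and B :: "'g \<Rightarrow> 'g"
    and \<omega>\<^sub>I :: "'g \<Rightarrow> 'g \<Rightarrow> 'k"
  assumes "factorizable_mock_pre_Lie_bialgebra scale Basis mul r"
    and "B = (\<lambda>x. scale wt (r_minus scale r (I_inv scale r x)))"
    and "\<omega>\<^sub>I = (\<lambda>x y. I_inv scale r x y)"
  shows "quadratic_Rota_Baxter_mock_pre_Lie_algebra scale Basis mul \<omega>\<^sub>I wt B"
proof -
  interpret factorizable_mock_pre_Lie_bialgebra scale Basis mul r
    by (rule assms(1))
  interpret quadratic_mock_pre_Lie_algebra scale Basis mul J
    by (rule quadratic_J)
  have B: "B x = scale wt (N x)" for x
    by (simp add: assms(2))
  have adj: "J (B x) y + J x (B y) + wt * J x y = 0" for x y
    using arg_cong[OF J_adjoint[of x y], of "(*) wt"] by (simp add: B form_simps algebra_simps)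
  have linear_N: "Vector_Spaces.linear scale scale N"
    using linear_skew_adjoint[of N 1] J_adjoint by simp
  \<comment> \<open>This is the weight-one identity for \<open>N\<close> multiplied by the square of
    \<open>wt\<close>; nothing is divided by \<open>wt\<close>, so weight zero is included.\<close>
  have "mul (B x) (B y) = B (mul (B x) y + mul x (B y) + scale wt (mul x y))" for x y
  proof -
    interpret N: Vector_Spaces.linear scale scale N
      by (rule linear_N)
    show ?thesis
      using Rota_Baxter_one[OF J_adjoint double_bracket_J, of x y]
      by (simp add: B mul_simps N.add N.scale scale_right_distrib)
  qed
  then show ?thesis
    using adj linear_skew_adjoint[of B wt]
    unfolding assms(3)
    by (intro quadratic_Rota_Baxter_mock_pre_Lie_algebra.intro quadratic_J
        quadratic_Rota_Baxter_mock_pre_Lie_algebra_axioms.intro) blast+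
qed

end
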